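(* Let $G$ be a finitely generated virtually nilpotent group with finite generating set $A$, $S=A\cup A^{-1}$, and let $\psi:L\to G$, $L\subseteq S^*$, be a Cayley automatic representation of $G$ whose function $h(n)=\max\{d_A(\pi(w),\psi(w)) : w\in L,|w|\le n\}$ satisfies $h\preceq p$ for some polynomial $p$. Then $L$ is simply starred.
   Context: A regular language is simply starred if it is given by a regular expression of the form $R_1\vee\cdots\vee R_I$ where each $R_i=v_{i,0}u_{i,1}^*v_{i,1}\cdots u_{i,P_i}^*v_{i,P_i}$ for strings $u_{i,j},v_{i,j}$. $\pi:S^*\to G$ is the evaluation map and $d_A$ the word metric. A Cayley automatic representation is a bijection $\psi:L\to G$ from a regular $L\subseteq S^*$ such that for each $a\in A$ the relation $\{(\psi^{-1}(g),\psi^{-1}(ga)) : g\in G\}$ is FA-recognizable (the language of convolutions — parallel readings of the two strings with the shorter padded by a new symbol — is regular). $g\preceq f$ means there exist $N\ge0$ and positive integers $K,M$ with $g(n)\le Kf(Mn)$ for all $n\ge N$. *)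

theory Defs
  imports "HOL-Algebra.Algebra" "HOL-Computational_Algebra.Polynomial"
begin

definition commutator_subgroup :: "('a, 'b) monoid_scheme \<Rightarrow> 'a set \<Rightarrow> 'a set \<Rightarrow> 'a set" where
  "commutator_subgroup G H K =
     generate G {h \<otimes>\<^bsub>G\<^esub> k \<otimes>\<^bsub>G\<^esub> inv\<^bsub>G\<^esub> h \<otimes>\<^bsub>G\<^esub> inv\<^bsub>G\<^esub> k | h k. h \<in> H \<and> k \<in> K}"

fun lower_central :: "('a, 'b) monoid_scheme \<Rightarrow> 'a set \<Rightarrow> nat \<Rightarrow> 'a set" where
  "lower_central G H 0 = H"
| "lower_central G H (Suc i) = commutator_subgroup G (lower_central G H i) H"

definition nilpotent_subgroup :: "('a, 'b) monoid_scheme \<Rightarrow> 'a set \<Rightarrow> bool" where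
  "nilpotent_subgroup G H \<longleftrightarrow> subgroup H G \<and> (\<exists>n. lower_central G H n = {\<one>\<^bsub>G\<^esub>})"

definition virtually_nilpotent :: "('a, 'b) monoid_scheme \<Rightarrow> bool" where
  "virtually_nilpotent G \<longleftrightarrow>
     (\<exists>H. nilpotent_subgroup G H \<and> finite (rcosets\<^bsub>G\<^esub> H))"

definition symm_gens :: "('a, 'b) monoid_scheme \<Rightarrow> 'a set \<Rightarrow> 'a set" where
  "symm_gens G A = A \<union> (\<lambda>x. inv\<^bsub>G\<^esub> x) ` A"

definition eval_word :: "('a, 'b) monoid_scheme \<Rightarrow> 'a list \<Rightarrow> 'a" where
  "eval_word G w = foldr (\<lambda>x y. x \<otimes>\<^bsub>G\<^esub> y) w \<one>\<^bsub>G\<^esub>"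

definition word_length :: "('a, 'b) monoid_scheme \<Rightarrow> 'a set \<Rightarrow> 'a \<Rightarrow> nat" where
  "word_length G A g =
     (LEAST n. \<exists>w \<in> lists (symm_gens G A). length w = n \<and> eval_word G w = g)"

definition word_dist :: "('a, 'b) monoid_scheme \<Rightarrow> 'a set \<Rightarrow> 'a \<Rightarrow> 'a \<Rightarrow> nat" where
  "word_dist G A g h = word_length G A (inv\<^bsub>G\<^esub> g \<otimes>\<^bsub>G\<^esub> h)"

definition regular_lang :: "'c set \<Rightarrow> 'c list set \<Rightarrow> bool" where
  "regular_lang \<Sigma> L \<longleftrightarrow> finite \<Sigma> \<and>
     (\<exists>(Q :: nat set) q0 (\<delta> :: nat \<Rightarrow> 'c \<Rightarrow> nat) F.
        finite Q \<and> q0 \<in> Q \<and> F \<subseteq> Q \<and> (\<forall>q\<in>Q. \<forall>c\<in>\<Sigma>. \<delta> q c \<in> Q) \<and>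
        L = {w \<in> lists \<Sigma>. foldl \<delta> q0 w \<in> F})"

definition convolution :: "'c list \<Rightarrow> 'c list \<Rightarrow> ('c option \<times> 'c option) list" where
  "convolution u v =
     map (\<lambda>i. (if i < length u then Some (u ! i) else None,
               if i < length v then Some (v ! i) else None))
         [0..<max (length u) (length v)]"

definition conv_alphabet :: "'c set \<Rightarrow> ('c option \<times> 'c option) set" where
  "conv_alphabet S = (insert None (Some ` S)) \<times> (insert None (Some ` S))"

definition cayley_automatic_rep ::
  "('a, 'b) monoid_scheme \<Rightarrow> 'a set \<Rightarrow> 'a list set \<Rightarrow> ('a list \<Rightarrow> 'a) \<Rightarrow> bool" where
  "cayley_automatic_rep G A L \<psi> \<longleftrightarrow>
     L \<subseteq> lists (symm_gens G A) \<and>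
     regular_lang (symm_gens G A) L \<and>
     bij_betw \<psi> L (carrier G) \<and>
     (\<forall>a\<in>A. regular_lang (conv_alphabet (symm_gens G A))
        {convolution (the_inv_into L \<psi> g) (the_inv_into L \<psi> (g \<otimes>\<^bsub>G\<^esub> a)) | g. g \<in> carrier G})"

definition preceq :: "(nat \<Rightarrow> real) \<Rightarrow> (nat \<Rightarrow> real) \<Rightarrow> bool" where
  "preceq g f \<longleftrightarrow> (\<exists>N K M. K > (0::nat) \<and> M > (0::nat) \<and>
      (\<forall>n\<ge>N. g n \<le> real K * f (M * n)))"

definition fellow_dist :: "('a, 'b) monoid_scheme \<Rightarrow> 'a set \<Rightarrow> 'a list set \<Rightarrow> ('a list \<Rightarrow> 'a) \<Rightarrow> nat \<Rightarrow> nat" where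
  "fellow_dist G A L \<psi> n =
     Max (insert 0 {word_dist G A (eval_word G w) (\<psi> w) | w. w \<in> L \<and> length w \<le> n})"

text \<open>A starred pattern (v0, [(u1,v1),...,(uP,vP)]) denotes v0 u1^* v1 ... uP^* vP.\<close>
fun pattern_lang :: "'c list \<Rightarrow> ('c list \<times> 'c list) list \<Rightarrow> 'c list set" where
  "pattern_lang v0 [] = {v0}"
| "pattern_lang v0 ((u, v) # rest) =
     {v0 @ concat (replicate k u) @ w | k w. w \<in> pattern_lang v rest}"

definition simply_starred :: "'c set \<Rightarrow> 'c list set \<Rightarrow> bool" where
  "simply_starred \<Sigma> L \<longleftrightarrow>
     (\<exists>Rs :: ('c list \<times> ('c list \<times> 'c list) list) list.
        (\<forall>(v0, ps) \<in> set Rs. v0 \<in> lists \<Sigma> \<and> (\<forall>(u, v) \<in> set ps. u \<in> lists \<Sigma> \<and> v \<in> lists \<Sigma>)) \<and>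
        L = (\<Union>(v0, ps) \<in> set Rs. pattern_lang v0 ps))"

end

theory Submission
  imports Defs
begin

text \<open>
  Since \<open>h\<close> is polynomially bounded, \<open>\<psi>\<close> embeds the words of \<open>L\<close> of length at most \<open>n\<close> into
  a ball of polynomial radius; balls in \<open>G\<close> grow polynomially, so \<open>L\<close> has polynomial growth.
  In an automaton for \<open>L\<close>, any two loops \<open>u, v\<close> at a state on an accepting run therefore
  commute: otherwise \<open>uv\<close> and \<open>vu\<close> would freely generate exponentially many accepted words.
  Hence the loops at a state are the powers of a single word, and cutting each accepting run
  at its last visits to states exhibits \<open>L\<close> as simply starred.

  Polynomial growth of a nilpotent group is obtained by moving one generator \<open>a\<close> at a time to
  the front of a word. This costs only conjugates \<open>a\<^sup>-\<^sup>k y a\<^sup>k\<close>, which are words of length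
  polynomial in \<open>k\<close> in the iterated commutators \<open>[y, a, \<dots>, a]\<close>; once all generators are collected,
  the remaining letters lie in the commutator subgroup, of smaller class.
\<close>

section \<open>Word balls and polynomial bounds\<close>

definition word_ball :: "('a, 'b) monoid_scheme \<Rightarrow> 'a set \<Rightarrow> nat \<Rightarrow> 'a set" where
  "word_ball G Z n = eval_word G ` {w \<in> lists Z. length w \<le> n}"

text \<open>The bound is required at every \<open>n\<close>, without a threshold; the base
  \<open>n + 1\<close> keeps it meaningful at \<open>n = 0\<close>.\<close>

definition polynomially_bounded :: "(nat \<Rightarrow> nat) \<Rightarrow> bool" where
  "polynomially_bounded f \<longleftrightarrow> (\<exists>C d. \<forall>n. f n \<le> C * (n + 1) ^ d)"

lemma finite_word_ball:
  assumes "finite Z"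
  shows "finite (word_ball G Z n)"
proof -
  have "finite {w. set w \<subseteq> Z \<and> length w \<le> n}"
    using assms by (rule finite_lists_length_le)
  then show ?thesis
    by (simp add: word_ball_def lists_eq_set)
qed

lemma word_ball_mono:
  "Z \<subseteq> Z' \<Longrightarrow> m \<le> n \<Longrightarrow> word_ball G Z m \<subseteq> word_ball G Z' n"
  unfolding word_ball_def by (intro image_mono) auto

lemma word_ball_weaken: "g \<in> word_ball G Z m \<Longrightarrow> m \<le> n \<Longrightarrow> g \<in> word_ball G Z n"
  unfolding word_ball_def by auto

context group
begin

lemma eval_word_closed:
  "w \<in> lists Z \<Longrightarrow> Z \<subseteq> carrier G \<Longrightarrow> eval_word G w \<in> carrier G"
  by (induction w) (auto simp: eval_word_def)

lemma eval_word_append: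
  "u \<in> lists Z \<Longrightarrow> v \<in> lists Z \<Longrightarrow> Z \<subseteq> carrier G \<Longrightarrow>
    eval_word G (u @ v) = eval_word G u \<otimes> eval_word G v"
proof (induction u)
  case Nil
  then show ?case
    using eval_word_closed[of v Z] by (simp add: eval_word_def)
next
  case (Cons x u)
  then have "eval_word G u \<in> carrier G" "eval_word G v \<in> carrier G" "x \<in> carrier G"
    using eval_word_closed by auto
  with Cons show ?case
    by (simp add: eval_word_def m_assoc)
qed

lemma word_ball_closed: "Z \<subseteq> carrier G \<Longrightarrow> word_ball G Z n \<subseteq> carrier G"
  unfolding word_ball_def using eval_word_closed by auto

lemma one_in_word_ball: "\<one> \<in> word_ball G Z n"
  unfolding word_ball_def by (rule image_eqI[of _ _ "[]"]) (auto simp: eval_word_def)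

lemma word_ball_mult:
  assumes "Z \<subseteq> carrier G" "g \<in> word_ball G Z m" "h \<in> word_ball G Z n"
  shows "g \<otimes> h \<in> word_ball G Z (m + n)"
proof -
  from assms obtain u v where u: "u \<in> lists Z" "length u \<le> m" "g = eval_word G u"
    and v: "v \<in> lists Z" "length v \<le> n" "h = eval_word G v"
    unfolding word_ball_def by auto
  have "g \<otimes> h = eval_word G (u @ v)"
    using u v eval_word_append assms(1) by simp
  moreover have "u @ v \<in> {w \<in> lists Z. length w \<le> m + n}"
    using u v by auto
  ultimately show ?thesis
    unfolding word_ball_def by blast
qed

lemma letter_in_word_ball:
  assumes "Z \<subseteq> carrier G" "z \<in> Z" "n \<ge> 1"
  shows "z \<in> word_ball G Z n"
  unfolding word_ball_def
  by (rule image_eqI[of _ _ "[z]"]) (use assms in \<open>auto simp: eval_word_def\<close>)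

section \<open>Lower central series and iterated commutators\<close>

lemma commutator_subgroup_mono:
  "H \<subseteq> H' \<Longrightarrow> K \<subseteq> K' \<Longrightarrow> commutator_subgroup G H K \<subseteq> commutator_subgroup G H' K'"
  unfolding commutator_subgroup_def by (rule mono_generate) blast

lemma subgroup_commutator_subgroup:
  assumes "H \<subseteq> carrier G" "K \<subseteq> carrier G"
  shows "subgroup (commutator_subgroup G H K) G"
  unfolding commutator_subgroup_def
  by (rule generate_is_subgroup) (auto dest!: subsetD[OF assms(1)] subsetD[OF assms(2)])

lemma subgroup_lower_central:
  "subgroup H G \<Longrightarrow> subgroup (lower_central G H i) G"
  by (induction i) (auto intro!: subgroup_commutator_subgroup dest: subgroup.subset)

text \<open>Passing to the commutator subgroup lowers the nilpotency class by one: both series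
  repeat the same commutator step, with a smaller second argument on the left-hand side. This drives
  the induction on the class.\<close>

lemma lower_central_derived:
  assumes "subgroup H G"
  shows "lower_central G H 1 \<subseteq> H"
    and "lower_central G (lower_central G H 1) i \<subseteq> lower_central G H (Suc i)"
proof -
  show *: "lower_central G H 1 \<subseteq> H"
    unfolding One_nat_def lower_central.simps commutator_subgroup_def
    by (rule generate_subgroup_incl[OF _ assms])
      (auto intro!: subgroup.m_closed[OF assms] subgroup.m_inv_closed[OF assms])
  show "lower_central G (lower_central G H 1) i \<subseteq> lower_central G H (Suc i)"
  proof (induction i)
    case (Suc i)
    then show ?case
      unfolding lower_central.simps(2)[of _ _ "Suc i"] lower_central.simps(2)[of _ "lower_central G H 1"]
      by (rule commutator_subgroup_mono) (rule *)
  qed simp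
qed

text \<open>This is \<open>[y, a]\<close> in the convention where \<open>y a = a y [y, a]\<close>.
  The fixed element \<open>a\<close> comes first so that \<open>right_comm a\<close> can be
  iterated.\<close>

definition right_comm :: "'a \<Rightarrow> 'a \<Rightarrow> 'a" where
  "right_comm a y = inv y \<otimes> inv a \<otimes> y \<otimes> a"

lemma right_comm_closed:
  "a \<in> carrier G \<Longrightarrow> y \<in> carrier G \<Longrightarrow> right_comm a y \<in> carrier G"
  by (simp add: right_comm_def)

lemma right_comm_one: "a \<in> carrier G \<Longrightarrow> right_comm a \<one> = \<one>"
  by (simp add: right_comm_def)

lemma right_comm_pow_one: "a \<in> carrier G \<Longrightarrow> (right_comm a ^^ j) \<one> = \<one>"
  by (induction j) (auto simp: right_comm_one)

text \<open>In the convention of \<open>commutator_subgroup\<close>, \<open>[z, a]\<close> is the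
  commutator of \<open>inv z\<close> and \<open>inv a\<close>, so each iteration descends one step
  in the series.\<close>

lemma right_comm_pow_lower_central:
  assumes H: "subgroup H G" and a: "a \<in> H" and y: "y \<in> H"
  shows "(right_comm a ^^ j) y \<in> lower_central G H j"
proof (induction j)
  case (Suc j)
  let ?z = "(right_comm a ^^ j) y"
  have z: "inv ?z \<in> lower_central G H j"
    using subgroup.m_inv_closed[OF subgroup_lower_central[OF H] Suc] .
  have a': "inv a \<in> H"
    using subgroup.m_inv_closed[OF H a] .
  have c: "?z \<in> carrier G" "a \<in> carrier G"
    using Suc subgroup.mem_carrier[OF subgroup_lower_central[OF H]] subgroup.mem_carrier[OF H a] by auto
  have "right_comm a ?z = inv ?z \<otimes> inv a \<otimes> inv (inv ?z) \<otimes> inv (inv a)"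
    using c by (simp add: right_comm_def)
  then show ?case
    unfolding lower_central.simps commutator_subgroup_def funpow.simps comp_def
    using z a' by (intro generate.incl) blast
qed (use y in simp)

text \<open>Conjugating \<open>y\<close> by \<open>a\<close> appends the letter \<open>[y, a]\<close>, whose own conjugates
  obey the bound with exponent \<open>m - 1\<close>; the exponents add up as in Pascal's triangle.\<close>

lemma conj_pow_in_word_ball:
  assumes a: "a \<in> carrier G" and Y: "Y \<subseteq> carrier G"
    and closed: "\<And>y. y \<in> Y \<Longrightarrow> right_comm a y \<in> Y"
  shows "y \<in> Y \<Longrightarrow> (right_comm a ^^ m) y = \<one> \<Longrightarrow>
    inv (a [^] k) \<otimes> y \<otimes> a [^] k \<in> word_ball G Y ((k + 1) ^ m)"
proof (induction k arbitrary: y m)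
  case 0
  then have "y \<in> carrier G" using Y by auto
  then show ?case using 0 letter_in_word_ball[OF Y] by simp
next
  case (Suc k)
  show ?case
  proof (cases m)
    case 0
    then show ?thesis using Suc.prems a by (simp add: one_in_word_ball)
  next
    case (Suc m')
    have y: "y \<in> carrier G" using Y Suc.prems by auto
    let ?b = "a [^] k"
    have b: "?b \<in> carrier G" using a by simp
    have r: "right_comm a y \<in> carrier G" using right_comm_closed[OF a y] .
    have "(right_comm a ^^ m') (right_comm a y) = \<one>"
      using Suc.prems(2) unfolding Suc by (simp only: funpow_Suc_right comp_def)
    then have 1: "inv ?b \<otimes> right_comm a y \<otimes> ?b \<in> word_ball G Y ((k + 1) ^ m')"
      using Suc.IH closed Suc.prems(1) by blast
    have 2: "inv ?b \<otimes> y \<otimes> ?b \<in> word_ball G Y ((k + 1) ^ m)"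
      using Suc.IH Suc.prems by blast
    \<comment> \<open>Splitting off \<open>a\<close> on the left means that \<open>y\<close> is
      conjugated by \<open>a\<close> first, which gives \<open>y [y, a]\<close>; the two factors are
      then conjugated by \<open>?b\<close> separately.\<close>
    have ak: "a [^] Suc k = a \<otimes> ?b"
      using a by (metis nat_pow_Suc2)
    have e: "a \<otimes> (inv a \<otimes> z) = z" "inv a \<otimes> (a \<otimes> z) = z"
      "?b \<otimes> (inv ?b \<otimes> z) = z" "y \<otimes> (inv y \<otimes> z) = z" if "z \<in> carrier G" for z
      using that a b y by (simp_all add: m_assoc[symmetric])
    have "inv (a [^] Suc k) \<otimes> y \<otimes> a [^] Suc k
        = (inv ?b \<otimes> y \<otimes> ?b) \<otimes> (inv ?b \<otimes> right_comm a y \<otimes> ?b)"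
      unfolding ak right_comm_def using a b y by (simp add: inv_mult_group m_assoc e)
    also have "\<dots> \<in> word_ball G Y ((k + 1) ^ m + (k + 1) ^ m')"
      by (rule word_ball_mult[OF Y 2 1])
    finally have "inv (a [^] Suc k) \<otimes> y \<otimes> a [^] Suc k \<in> word_ball G Y ((k + 1) ^ m + (k + 1) ^ m')" .
    moreover have "(k + 1) ^ m + (k + 1) ^ m' \<le> (Suc k + 1) ^ m"
    proof -
      have "(k + 1) ^ m + (k + 1) ^ m' = (k + 2) * (k + 1) ^ m'"
        using Suc by (simp add: algebra_simps)
      also have "\<dots> \<le> (k + 2) * (k + 2) ^ m'"
        by (intro mult_left_mono power_mono) auto
      finally show ?thesis using Suc by simp
    qed
    ultimately show ?thesis
      using word_ball_weaken by metis
  qed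
qed

text \<open>A letter \<open>x\<close> of \<open>Y\<close> passes a block of \<open>a\<close> by
  \<open>x a^k = a^k (a^-k x a^k)\<close>. Since \<open>k \<le> n\<close>, each such passage costs
  at most \<open>(n + 1) ^ m\<close> letters of \<open>Y\<close>, and there are at most
  \<open>n\<close> of them.\<close>

lemma word_ball_insert_subset:
  assumes a: "a \<in> carrier G" and Y: "Y \<subseteq> carrier G"
    and closed: "\<And>y. y \<in> Y \<Longrightarrow> right_comm a y \<in> Y"
    and nil: "\<And>y. y \<in> Y \<Longrightarrow> (right_comm a ^^ m) y = \<one>"
  shows "word_ball G (insert a Y) n \<subseteq>
    (\<lambda>(k, b). a [^] k \<otimes> b) ` ({..n} \<times> word_ball G Y (n * (n + 1) ^ m))"
proof -
  have *: "\<exists>k \<le> length w. \<exists>b \<in> word_ball G Y (length w * (n + 1) ^ m). eval_word G w = a [^] k \<otimes> b"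
    if "w \<in> lists (insert a Y)" "length w \<le> n" for w
    using that
  proof (induction w)
    case Nil
    then show ?case
      using one_in_word_ball by (auto simp: eval_word_def intro!: bexI[of _ "\<one>"])
  next
    case (Cons x w)
    then obtain k b where kb: "k \<le> length w" "b \<in> word_ball G Y (length w * (n + 1) ^ m)"
      "eval_word G w = a [^] k \<otimes> b" by auto
    have b: "b \<in> carrier G" using kb(2) word_ball_closed[OF Y] by blast
    have ev: "eval_word G (x # w) = x \<otimes> (a [^] k \<otimes> b)"
      using kb(3) by (simp add: eval_word_def)
    show ?case
    proof (cases "x = a")
      case True
      have "a [^] Suc k = a \<otimes> a [^] k" using a by (metis nat_pow_Suc2)
      then have "eval_word G (x # w) = a [^] Suc k \<otimes> b"
        using ev True a b by (simp add: m_assoc)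
      moreover have "b \<in> word_ball G Y (length (x # w) * (n + 1) ^ m)"
        by (rule word_ball_weaken[OF kb(2)]) simp
      ultimately show ?thesis
        using kb(1) by (intro exI[of _ "Suc k"]) auto
    next
      case False
      then have xY: "x \<in> Y" using Cons by auto
      then have x: "x \<in> carrier G" using Y by auto
      let ?c = "inv (a [^] k) \<otimes> x \<otimes> a [^] k"
      have "?c \<in> word_ball G Y ((k + 1) ^ m)"
        using conj_pow_in_word_ball[OF a Y closed xY nil[OF xY]] .
      moreover have "(k + 1) ^ m \<le> (n + 1) ^ m"
        using kb(1) Cons.prems by (intro power_mono) auto
      ultimately have c: "?c \<in> word_ball G Y ((n + 1) ^ m)"
        using word_ball_weaken by metis
      have "?c \<otimes> b \<in> word_ball G Y ((n + 1) ^ m + length w * (n + 1) ^ m)"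
        by (rule word_ball_mult[OF Y c kb(2)])
      moreover have "eval_word G (x # w) = a [^] k \<otimes> (?c \<otimes> b)"
      proof -
        have "a [^] k \<otimes> (inv (a [^] k) \<otimes> z) = z" if "z \<in> carrier G" for z
          using that a by (simp add: m_assoc[symmetric])
        then show ?thesis
          using ev a b x by (simp add: m_assoc)
      qed
      ultimately show ?thesis
        using kb(1) by (intro exI[of _ k]) auto
    qed
  qed
  show ?thesis
  proof
    fix g assume "g \<in> word_ball G (insert a Y) n"
    then obtain w where w: "w \<in> lists (insert a Y)" "length w \<le> n" "g = eval_word G w"
      unfolding word_ball_def by auto
    from *[OF w(1,2)] obtain k b where kb: "k \<le> length w"
      "b \<in> word_ball G Y (length w * (n + 1) ^ m)" "g = a [^] k \<otimes> b"
      using w(3) by auto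
    have "b \<in> word_ball G Y (n * (n + 1) ^ m)"
      by (rule word_ball_weaken[OF kb(2)]) (use w(2) in simp)
    then show "g \<in> (\<lambda>(k, b). a [^] k \<otimes> b) ` ({..n} \<times> word_ball G Y (n * (n + 1) ^ m))"
      using kb w(2) by auto
  qed
qed

section \<open>Polynomial growth of nilpotent and virtually nilpotent groups\<close>

text \<open>The outer induction is on the class, for all subgroups \<open>H\<close> at once; the
  inner one is on the letters not yet collected. Collecting a letter creates new letters, but all of
  them are commutators, so the inner induction does not notice them.\<close>

lemma nilpotent_growth:
  assumes "subgroup H G" "lower_central G H c = {\<one>}" "finite Z" "Z \<subseteq> H"
  shows "polynomially_bounded (\<lambda>n. card (word_ball G Z n))"
  using assms
proof (induction c arbitrary: H Z)
  case 0
  then have Z: "Z \<subseteq> {\<one>}" by auto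
  have "word_ball G Z n \<subseteq> {\<one>}" for n
  proof -
    have "eval_word G w = \<one>" if "w \<in> lists Z" for w
      using that Z by (induction w) (auto simp: eval_word_def)
    then show ?thesis unfolding word_ball_def by auto
  qed
  then have "card (word_ball G Z n) \<le> 1" for n
    using card_mono[of "{\<one>}"] by (metis card_1_singleton_iff finite.emptyI finite.insertI One_nat_def)
  then show ?case
    unfolding polynomially_bounded_def by (intro exI[of _ 1] exI[of _ 0]) auto
next
  case (Suc c)
  note H = Suc.prems(1)
  let ?D = "lower_central G H 1"
  let ?m = "Suc c"
  have HG: "H \<subseteq> carrier G" using H subgroup.subset by auto
  have D: "subgroup ?D G" using subgroup_lower_central[OF H] .
  have "lower_central G ?D c = {\<one>}"
    using lower_central_derived(2)[OF H, of c] Suc.prems(2)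
      subgroup.one_closed[OF subgroup_lower_central[OF D, of c]] by auto
  note IH = Suc.IH[OF D this]
  have nilp: "(right_comm a ^^ ?m) y = \<one>" if "a \<in> H" "y \<in> H" for a y
    using right_comm_pow_lower_central[OF H that, of ?m] Suc.prems(2) by auto
  \<comment> \<open>\<open>V\<close> holds the letters still to be collected. \<open>W\<close> stays
    arbitrary in the induction because it absorbs the new commutators; once \<open>V\<close> is
    empty, the hypothesis for the smaller class applies to \<open>W\<close>.\<close>
  have "polynomially_bounded (\<lambda>n. card (word_ball G (V \<union> W) n))"
    if "finite V" "V \<subseteq> H" "finite W" "W \<subseteq> ?D" for V W
    using that
  proof (induction V arbitrary: W rule: finite_induct)
    case empty
    then show ?case using IH by simp
  next
    case (insert a V)
    have aH: "a \<in> H" and V: "V \<subseteq> H" using insert.prems by auto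
    have a: "a \<in> carrier G" using aH HG by auto
    have XW: "V \<union> W \<subseteq> H"
      using V insert.prems lower_central_derived(1)[OF H] by auto
    \<comment> \<open>Stopping the iteration at \<open>?m\<close> loses nothing, since that iterate
      is already \<open>\<one>\<close>; so \<open>Y\<close> is finite and closed under
      \<open>right_comm a\<close>.\<close>
    define Y where "Y = (\<lambda>(j, y). (right_comm a ^^ j) y) ` ({..?m} \<times> (V \<union> W))"
    have YI: "(right_comm a ^^ j) y \<in> Y" if "y \<in> V \<union> W" "j \<le> ?m" for j y
      unfolding Y_def using that by force
    have Y: "Y \<subseteq> carrier G"
    proof
      fix z assume "z \<in> Y"
      then obtain j y where "z = (right_comm a ^^ j) y" "y \<in> V \<union> W"
        unfolding Y_def by auto
      then show "z \<in> carrier G"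
        using right_comm_pow_lower_central[OF H aH] XW
          subgroup.mem_carrier[OF subgroup_lower_central[OF H]] by blast
    qed
    have finY: "finite Y"
      unfolding Y_def using insert.hyps insert.prems by auto
    have closed: "right_comm a z \<in> Y" if "z \<in> Y" for z
    proof -
      from that obtain j y where z: "z = (right_comm a ^^ j) y" "y \<in> V \<union> W" "j \<le> ?m"
        unfolding Y_def by auto
      show ?thesis
      proof (cases "j = ?m")
        case True
        then have "z = \<one>" using nilp aH XW z by blast
        then have "right_comm a z = z" using right_comm_one[OF a] by simp
        then show ?thesis using that by simp
      next
        case False
        then have "(right_comm a ^^ Suc j) y \<in> Y" using z by (intro YI) auto
        then show ?thesis using z by simp
      qed
    qed
    have nil: "(right_comm a ^^ ?m) z = \<one>" if "z \<in> Y" for z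
    proof -
      from that obtain j y where z: "z = (right_comm a ^^ j) y" "y \<in> V \<union> W"
        unfolding Y_def by auto
      have "(right_comm a ^^ ?m) z = (right_comm a ^^ j) ((right_comm a ^^ ?m) y)"
        unfolding z(1) by (metis add.commute comp_apply funpow_add)
      also have "\<dots> = \<one>"
        using nilp[OF aH] XW z(2) right_comm_pow_one[OF a] by (metis subsetD)
      finally show ?thesis .
    qed
    let ?W = "Y \<inter> ?D"
    \<comment> \<open>Iterates with \<open>j > 0\<close> are commutators and lie in
      \<open>?D\<close>, so only the old letters of \<open>V\<close> remain to be collected.\<close>
    have split: "Y \<subseteq> V \<union> ?W"
    proof
      fix z assume zY: "z \<in> Y"
      then obtain j y where z: "z = (right_comm a ^^ j) y" "y \<in> V \<union> W"
        unfolding Y_def by auto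
      show "z \<in> V \<union> ?W"
      proof (cases j)
        case 0
        then show ?thesis using z zY insert.prems by auto
      next
        case (Suc i)
        have "(right_comm a ^^ i) y \<in> H"
        proof -
          have "right_comm a x \<in> H" if "x \<in> H" for x
            unfolding right_comm_def using that aH
            by (intro subgroup.m_closed[OF H] subgroup.m_inv_closed[OF H])
          then show ?thesis using z(2) XW by (induction i) auto
        qed
        then have "z \<in> ?D"
          using right_comm_pow_lower_central[OF H aH, of "(right_comm a ^^ i) y" 1] z(1) Suc by simp
        then show ?thesis using zY by simp
      qed
    qed
    obtain C d where Cd: "\<And>n. card (word_ball G (V \<union> ?W) n) \<le> C * (n + 1) ^ d"
      using insert.IH[of ?W] V finY unfolding polynomially_bounded_def by auto
    \<comment> \<open>One factor \<open>n + 1\<close> counts the powers of \<open>a\<close>; the new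
      radius satisfies \<open>?N + 1 \<le> (n + 1) ^ (?m + 1)\<close>, which is raised to the power
      \<open>d\<close>.\<close>
    have "card (word_ball G (insert a V \<union> W) n) \<le> C * (n + 1) ^ (Suc ((?m + 1) * d))" for n
    proof -
      let ?N = "n * (n + 1) ^ ?m"
      let ?P = "{..n} \<times> word_ball G (V \<union> ?W) ?N"
      have finP: "finite ?P"
        using insert.hyps finY by (intro finite_cartesian_product finite_word_ball) auto
      have "insert a V \<union> W \<subseteq> insert a Y"
        using YI[of _ 0] by auto
      then have "word_ball G (insert a V \<union> W) n \<subseteq> word_ball G (insert a Y) n"
        by (intro word_ball_mono) auto
      also have "\<dots> \<subseteq> (\<lambda>(k, b). a [^] k \<otimes> b) ` ({..n} \<times> word_ball G Y ?N)"
        by (rule word_ball_insert_subset[OF a Y closed nil])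
      also have "\<dots> \<subseteq> (\<lambda>(k, b). a [^] k \<otimes> b) ` ?P"
        using word_ball_mono[OF split order.refl, of G ?N] by (intro image_mono) auto
      finally have "card (word_ball G (insert a V \<union> W) n) \<le> card ((\<lambda>(k, b). a [^] k \<otimes> b) ` ?P)"
        using finP by (intro card_mono) auto
      also have "\<dots> \<le> card ?P"
        using finP by (rule card_image_le)
      also have "\<dots> = (n + 1) * card (word_ball G (V \<union> ?W) ?N)"
        by (simp add: card_cartesian_product)
      also have "\<dots> \<le> (n + 1) * (C * (?N + 1) ^ d)"
        using Cd by (intro mult_left_mono) auto
      also have "\<dots> \<le> (n + 1) * (C * ((n + 1) ^ (?m + 1)) ^ d)"
      proof -
        have "?N + 1 \<le> ?N + (n + 1) ^ ?m"
          by (intro add_left_mono one_le_power) simp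
        also have "\<dots> = (n + 1) ^ (?m + 1)" by (simp add: algebra_simps)
        finally show ?thesis by (intro mult_left_mono power_mono) auto
      qed
      also have "\<dots> = C * (n + 1) ^ (Suc ((?m + 1) * d))"
        by (simp only: power_mult power_Suc mult.left_commute)
      finally show ?thesis .
    qed
    then show ?case unfolding polynomially_bounded_def by blast
  qed
  from this[of Z "{}"] show ?case using Suc.prems by simp
qed

text \<open>Schreier's rewriting: with a transversal \<open>T\<close> of \<open>H\<close>, each product \<open>t s\<close> is \<open>z t'\<close>
  with \<open>z\<close> from a finite subset of \<open>H\<close>.\<close>

lemma virtually_nilpotent_growth:
  assumes vn: "virtually_nilpotent G" and S: "finite S" "S \<subseteq> carrier G"
  shows "polynomially_bounded (\<lambda>n. card (word_ball G S n))"
proof -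
  obtain H c where H: "subgroup H G" "lower_central G H c = {\<one>}" and fin: "finite (rcosets H)"
    using vn unfolding virtually_nilpotent_def nilpotent_subgroup_def by auto
  have HG: "H \<subseteq> carrier G" using H subgroup.subset by auto
  define r :: "'a set \<Rightarrow> 'a" where "r = (\<lambda>C. SOME x. x \<in> C)"
  have r: "r C \<in> C" if "C \<in> rcosets H" for C
  proof -
    from that obtain x where x: "x \<in> carrier G" "C = H #> x" unfolding RCOSETS_def by auto
    then have "x \<in> C" using rcos_self H by auto
    then show ?thesis unfolding r_def by (rule someI)
  qed
  define T where "T = r ` (rcosets H)"
  have T: "finite T" using fin T_def by auto
  have TG: "T \<subseteq> carrier G"
    unfolding T_def using r r_coset_subset_G[OF HG] by (fastforce simp: RCOSETS_def)
  have dec: "\<exists>h\<in>H. \<exists>t\<in>T. g = h \<otimes> t" if g: "g \<in> carrier G" for g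
  proof -
    have C: "H #> g \<in> rcosets H" using g HG by (auto simp: RCOSETS_def)
    let ?t = "r (H #> g)"
    obtain h where h: "h \<in> H" "?t = h \<otimes> g" using r[OF C] unfolding r_coset_def by auto
    have "g = inv h \<otimes> ?t" using h g HG by (auto simp: m_assoc[symmetric])
    then show ?thesis using h subgroup.m_inv_closed[OF H(1)] C unfolding T_def by blast
  qed
  \<comment> \<open>The Schreier generators: finitely many candidates \<open>t s t'^-1\<close>, of
    which those in \<open>H\<close> are kept.\<close>
  define Z where "Z = H \<inter> (\<lambda>(t, s, t'). t \<otimes> s \<otimes> inv t') ` (T \<times> S \<times> T)"
  have Z: "finite Z" "Z \<subseteq> H" using T S unfolding Z_def by auto
  have ZG: "Z \<subseteq> carrier G" using Z HG by auto
  \<comment> \<open>Each letter of \<open>S\<close> yields exactly one letter of \<open>Z\<close>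
    while the representative moves to the right, so the length does not grow.\<close>
  have rewr: "\<exists>b \<in> word_ball G Z (length w). \<exists>t'\<in>T. t \<otimes> eval_word G w = b \<otimes> t'"
    if "w \<in> lists S" "t \<in> T" for w t
    using that
  proof (induction w arbitrary: t)
    case Nil
    then have "t \<in> carrier G" using TG by auto
    then have "t \<otimes> eval_word G [] = \<one> \<otimes> t" by (simp add: eval_word_def)
    then show ?case using one_in_word_ball Nil by blast
  next
    case (Cons s w)
    then have s: "s \<in> S" "s \<in> carrier G" and t: "t \<in> carrier G" using S TG by auto
    have ew: "eval_word G w \<in> carrier G" using eval_word_closed[OF _ S(2)] Cons by auto
    obtain h t1 where h: "h \<in> H" "t1 \<in> T" "t \<otimes> s = h \<otimes> t1" using dec[of "t \<otimes> s"] s t by auto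
    have hc: "h \<in> carrier G" "t1 \<in> carrier G" using h HG TG by auto
    have "h = t \<otimes> s \<otimes> inv t1" using h hc by (simp add: m_assoc)
    then have "h \<in> Z" unfolding Z_def using h s Cons.prems by force
    then have hb: "h \<in> word_ball G Z 1" using letter_in_word_ball[OF ZG] by simp
    from Cons.IH[OF h(2)] obtain b t' where b: "b \<in> word_ball G Z (length w)" "t' \<in> T"
      "t1 \<otimes> eval_word G w = b \<otimes> t'" by auto
    have bc: "b \<in> carrier G" "t' \<in> carrier G" using b word_ball_closed[OF ZG] TG by auto
    have "t \<otimes> eval_word G (s # w) = t \<otimes> s \<otimes> eval_word G w"
      using s t ew by (simp add: eval_word_def m_assoc)
    also have "\<dots> = h \<otimes> (t1 \<otimes> eval_word G w)" using h hc ew by (simp add: m_assoc)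
    also have "\<dots> = (h \<otimes> b) \<otimes> t'" using b bc hc by (simp add: m_assoc)
    finally show ?case
      using word_ball_mult[OF ZG hb b(1)] b(2) by auto
  qed
  \<comment> \<open>The rewriting must start at some representative, and \<open>\<one>\<close> need
    not be in \<open>T\<close>; the factor \<open>t0\<close> is cancelled afterwards.\<close>
  obtain t0 where t0: "t0 \<in> T" using dec[OF one_closed] by auto
  have t0c: "t0 \<in> carrier G" using t0 TG by auto
  obtain C d where Cd: "\<And>n. card (word_ball G Z n) \<le> C * (n + 1) ^ d"
    using nilpotent_growth[OF H Z] unfolding polynomially_bounded_def by auto
  have "card (word_ball G S n) \<le> (C * card T) * (n + 1) ^ d" for n
  proof -
    let ?P = "word_ball G Z n \<times> T"
    have finP: "finite ?P" using Z T by (auto intro: finite_word_ball)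
    have "word_ball G S n \<subseteq> (\<lambda>(b, t). inv t0 \<otimes> (b \<otimes> t)) ` ?P"
    proof
      fix g assume "g \<in> word_ball G S n"
      then obtain w where w: "w \<in> lists S" "length w \<le> n" "g = eval_word G w"
        unfolding word_ball_def by auto
      obtain b t where b: "b \<in> word_ball G Z (length w)" "t \<in> T" "t0 \<otimes> g = b \<otimes> t"
        using rewr[OF w(1) t0] w(3) by auto
      have "g \<in> carrier G" using eval_word_closed[OF w(1) S(2)] w(3) by simp
      then have "g = inv t0 \<otimes> (t0 \<otimes> g)" using t0c by (simp add: m_assoc[symmetric])
      then have "g = inv t0 \<otimes> (b \<otimes> t)" using b(3) by simp
      moreover have "b \<in> word_ball G Z n" using b(1) w(2) by (rule word_ball_weaken)
      ultimately show "g \<in> (\<lambda>(b, t). inv t0 \<otimes> (b \<otimes> t)) ` ?P"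
        using b(2) by force
    qed
    then have "card (word_ball G S n) \<le> card ?P"
      by (rule surj_card_le[OF finP])
    also have "\<dots> \<le> (C * (n + 1) ^ d) * card T"
      using Cd[of n] by (simp add: card_cartesian_product)
    finally show ?thesis by (simp add: mult_ac)
  qed
  then show ?thesis unfolding polynomially_bounded_def by blast
qed

end

section \<open>Loops in automata for languages of polynomial growth\<close>

lemma exponential_not_polynomially_bounded: "\<not> polynomially_bounded (\<lambda>n. 2 ^ n)"
proof
  assume "polynomially_bounded (\<lambda>n. 2 ^ n)"
  then obtain C d where Cd: "\<And>n. 2 ^ n \<le> C * (n + 1) ^ d"
    unfolding polynomially_bounded_def by auto
  \<comment> \<open>The bound at \<open>Suc d * m\<close> compares \<open>m ^ Suc d\<close> with
    \<open>C * (d + 2) ^ d * m ^ d\<close>; this \<open>m\<close> is just too large for it.\<close>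
  define m where "m = C * (d + 2) ^ d + 1"
  have "m * m ^ d = m ^ Suc d" by simp
  also have "\<dots> \<le> (2 ^ m) ^ Suc d"
    by (intro power_mono) (auto intro: less_imp_le[OF less_exp])
  also have "\<dots> = 2 ^ (Suc d * m)" by (simp add: power_mult[symmetric] power_add mult.commute)
  also have "\<dots> \<le> C * (Suc d * m + 1) ^ d" by (rule Cd)
  also have "\<dots> \<le> C * ((d + 2) * m) ^ d"
    by (intro mult_left_mono power_mono) (auto simp: m_def algebra_simps)
  also have "\<dots> = C * (d + 2) ^ d * m ^ d" by (simp only: power_mult_distrib mult.assoc)
  finally have "m \<le> C * (d + 2) ^ d"
    by (subst (asm) mult_le_cancel2) (auto simp: m_def)
  then show False by (simp add: m_def)
qed

text \<open>The blocks \<open>u @ v\<close> and \<open>v @ u\<close> have equal length, unlike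
  \<open>u\<close> and \<open>v\<close> in general. If they differ, a concatenation of
  \<open>n\<close> blocks can therefore be decoded uniquely, giving \<open>2 ^ n\<close> words of
  length linear in \<open>n\<close>.\<close>

lemma loops_commute:
  assumes fin: "\<And>n. finite {w \<in> L. length w \<le> n}"
    and growth: "polynomially_bounded (\<lambda>n. card {w \<in> L. length w \<le> n})"
    and L: "\<And>bs. set bs \<subseteq> {u @ v, v @ u} \<Longrightarrow> x @ concat bs @ y \<in> L"
  shows "u @ v = v @ u"
proof (rule ccontr)
  assume ne: "u @ v \<noteq> v @ u"
  obtain C d where Cd: "\<And>n. card {w \<in> L. length w \<le> n} \<le> C * (n + 1) ^ d"
    using growth unfolding polynomially_bounded_def by auto
  define a where "a = length x + length y"
  define l where "l = length u + length v"
  have "2 ^ n \<le> (C * (a + l + 1) ^ d) * (n + 1) ^ d" for n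
  proof -
    let ?B = "{bs. set bs \<subseteq> {u @ v, v @ u} \<and> length bs = n}"
    let ?f = "\<lambda>bs. x @ concat bs @ y"
    have len: "length (concat bs) = length bs * l" if "set bs \<subseteq> {u @ v, v @ u}" for bs
      using that by (induction bs) (auto simp: l_def)
    have inj: "inj_on ?f ?B"
    proof (rule inj_onI)
      fix bs bs' assume bs: "bs \<in> ?B" "bs' \<in> ?B" and "?f bs = ?f bs'"
      then have c: "concat bs = concat bs'" by simp
      show "bs = bs'"
      proof (rule concat_injective[OF c])
        show "length bs = length bs'" using bs by simp
        have block: "length p = l" if "p \<in> set bs \<union> set bs'" for p
          using that bs by (auto simp: l_def)
        show "\<forall>(p, q) \<in> set (zip bs bs'). length p = length q"
        proof (intro ballI, clarify)
          fix p q assume "(p, q) \<in> set (zip bs bs')"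
          then have "p \<in> set bs" "q \<in> set bs'" by (auto dest: set_zip_leftD set_zip_rightD)
          then show "length p = length q" using block by simp
        qed
      qed
    qed
    have "2 ^ n = card ?B" using ne by (subst card_lists_length_eq) (auto simp: numeral_2_eq_2)
    also have "\<dots> = card (?f ` ?B)" using card_image[OF inj] by simp
    also have "\<dots> \<le> card {w \<in> L. length w \<le> a + n * l}"
      using L len by (intro card_mono fin) (auto simp: a_def)
    also have "\<dots> \<le> C * (a + n * l + 1) ^ d" by (rule Cd)
    also have "\<dots> \<le> C * ((a + l + 1) * (n + 1)) ^ d"
      by (intro mult_left_mono power_mono) (auto simp: algebra_simps)
    finally show ?thesis by (simp only: power_mult_distrib mult.assoc)
  qed
  then show False
    using exponential_not_polynomially_bounded unfolding polynomially_bounded_def by blast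
qed

text \<open>The shortest nonempty loop \<open>u\<close> is a prefix of every other loop, because loops commute;
  determinism makes what remains after removing \<open>u\<close> a loop again.\<close>

lemma commuting_loops_are_powers:
  fixes \<delta> :: "'q \<Rightarrow> 'c \<Rightarrow> 'q"
  assumes comm: "\<And>u v. u \<in> lists \<Sigma> \<Longrightarrow> v \<in> lists \<Sigma> \<Longrightarrow> foldl \<delta> q u = q \<Longrightarrow>
    foldl \<delta> q v = q \<Longrightarrow> u @ v = v @ u"
  obtains u where "u \<in> lists \<Sigma>" "foldl \<delta> q u = q"
    "\<And>v. v \<in> lists \<Sigma> \<Longrightarrow> foldl \<delta> q v = q \<Longrightarrow> \<exists>k. v = concat (replicate k u)"
proof (cases "\<exists>v. v \<in> lists \<Sigma> \<and> foldl \<delta> q v = q \<and> v \<noteq> []")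
  case False
  show ?thesis
  \<comment> \<open>If the only loop is the empty word, the star is taken over the empty
    word.\<close>
  proof (rule that[of "[]"])
    fix v assume "v \<in> lists \<Sigma>" "foldl \<delta> q v = q"
    then have "v = []" using False by blast
    then show "\<exists>k. v = concat (replicate k [])" by simp
  qed auto
next
  case True
  let ?P = "\<lambda>v. v \<in> lists \<Sigma> \<and> foldl \<delta> q v = q \<and> v \<noteq> []"
  from True obtain v0 where "?P v0" ..
  from ex_has_least_nat[of ?P, OF this, of length]
  obtain u where u: "u \<in> lists \<Sigma>" "foldl \<delta> q u = q" "u \<noteq> []"
    and min: "\<And>v. v \<in> lists \<Sigma> \<Longrightarrow> foldl \<delta> q v = q \<Longrightarrow> v \<noteq> [] \<Longrightarrow> length u \<le> length v"
    by blast
  show ?thesis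
  proof (rule that[OF u(1,2)])
    fix v assume "v \<in> lists \<Sigma>" "foldl \<delta> q v = q"
    then show "\<exists>k. v = concat (replicate k u)"
    proof (induction v rule: length_induct)
      case (1 v)
      show ?case
      proof (cases "v = []")
        case True
        then show ?thesis by (intro exI[of _ 0]) simp
      next
        case False
        then have len: "length u \<le> length v" using min 1 by blast
        have "u @ v = v @ u" using comm u 1 by blast
        then have "take (length u) v = u"
          using len by (metis append_eq_conv_conj take_append diff_is_0_eq take_0 append_Nil2)
        then obtain v' where v': "v = u @ v'" by (metis append_take_drop_id)
        have "foldl \<delta> q v' = q" using 1(3) u(2) by (simp add: v')
        moreover have "v' \<in> lists \<Sigma>" "length v' < length v" using 1(2) u(3) by (auto simp: v')
        ultimately obtain k where "v' = concat (replicate k u)" using 1(1) by blast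
        then show ?thesis by (intro exI[of _ "Suc k"]) (simp add: v')
      qed
    qed
  qed
qed

section \<open>Simply starred languages: closure properties and decomposition of accepted
  runs\<close>

lemma simply_starred_empty: "simply_starred \<Sigma> {}"
  unfolding simply_starred_def by (intro exI[of _ "[]"]) simp

lemma simply_starred_Nil: "simply_starred \<Sigma> {[]}"
  unfolding simply_starred_def by (intro exI[of _ "[([], [])]"]) simp

lemma simply_starred_Un:
  assumes "simply_starred \<Sigma> L" "simply_starred \<Sigma> L'"
  shows "simply_starred \<Sigma> (L \<union> L')"
proof -
  from assms obtain Rs Rs' where
    "\<forall>(v0, ps) \<in> set Rs. v0 \<in> lists \<Sigma> \<and> (\<forall>(u, v) \<in> set ps. u \<in> lists \<Sigma> \<and> v \<in> lists \<Sigma>)"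
    "L = (\<Union>(v0, ps) \<in> set Rs. pattern_lang v0 ps)"
    "\<forall>(v0, ps) \<in> set Rs'. v0 \<in> lists \<Sigma> \<and> (\<forall>(u, v) \<in> set ps. u \<in> lists \<Sigma> \<and> v \<in> lists \<Sigma>)"
    "L' = (\<Union>(v0, ps) \<in> set Rs'. pattern_lang v0 ps)"
    unfolding simply_starred_def by blast
  then show ?thesis
    unfolding simply_starred_def by (intro exI[of _ "Rs @ Rs'"]) (simp add: ball_Un)
qed

lemma simply_starred_UN:
  assumes "finite I" "\<And>i. i \<in> I \<Longrightarrow> simply_starred \<Sigma> (f i)"
  shows "simply_starred \<Sigma> (\<Union>i\<in>I. f i)"
  using assms by (induction I) (auto intro: simply_starred_empty simply_starred_Un)

lemma pattern_lang_append_left: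
  "pattern_lang (w @ v0) ps = (@) w ` pattern_lang v0 ps"
proof (cases ps)
  case (Cons p ps')
  then show ?thesis by (cases p) (auto simp: image_iff)
qed simp

lemma simply_starred_append_left:
  assumes "w \<in> lists \<Sigma>" "simply_starred \<Sigma> L"
  shows "simply_starred \<Sigma> ((@) w ` L)"
proof -
  from assms obtain Rs where
    Rs: "\<forall>(v0, ps) \<in> set Rs. v0 \<in> lists \<Sigma> \<and> (\<forall>(u, v) \<in> set ps. u \<in> lists \<Sigma> \<and> v \<in> lists \<Sigma>)"
    and L: "L = (\<Union>(v0, ps) \<in> set Rs. pattern_lang v0 ps)"
    unfolding simply_starred_def by blast
  show ?thesis
    unfolding simply_starred_def
  proof (intro exI[of _ "map (\<lambda>(v0, ps). (w @ v0, ps)) Rs"] conjI)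
    show "(@) w ` L = (\<Union>(v0, ps) \<in> set (map (\<lambda>(v0, ps). (w @ v0, ps)) Rs). pattern_lang v0 ps)"
      unfolding L by (auto simp: pattern_lang_append_left case_prod_unfold)
  qed (use assms Rs in \<open>simp add: case_prod_unfold\<close>)
qed

text \<open>The old leading word \<open>v0\<close> becomes the word after the new star, and the new
  leading word is empty.\<close>

lemma simply_starred_star_left:
  assumes "u \<in> lists \<Sigma>" "simply_starred \<Sigma> L"
  shows "simply_starred \<Sigma> {concat (replicate k u) @ w | k w. w \<in> L}"
proof -
  from assms obtain Rs where
    Rs: "\<forall>(v0, ps) \<in> set Rs. v0 \<in> lists \<Sigma> \<and> (\<forall>(u, v) \<in> set ps. u \<in> lists \<Sigma> \<and> v \<in> lists \<Sigma>)"
    and L: "L = (\<Union>(v0, ps) \<in> set Rs. pattern_lang v0 ps)"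
    unfolding simply_starred_def by blast
  show ?thesis
    unfolding simply_starred_def
  proof (intro exI[of _ "map (\<lambda>(v0, ps). ([], (u, v0) # ps)) Rs"] conjI)
    show "{concat (replicate k u) @ w | k w. w \<in> L} =
      (\<Union>(v0, ps) \<in> set (map (\<lambda>(v0, ps). ([], (u, v0) # ps)) Rs). pattern_lang v0 ps)"
      unfolding L by (auto simp: case_prod_unfold)
  qed (use assms Rs in \<open>auto simp: case_prod_unfold\<close>)
qed

text \<open>The starred language \<open>R\<close> is only pinned between two languages: the power of \<open>u\<close> split off
  at the last visit to \<open>q\<close> need not avoid \<open>B\<close>.\<close>

lemma accepted_sandwich:
  fixes \<delta> :: "'q \<Rightarrow> 'c \<Rightarrow> 'q"
  assumes \<Sigma>: "finite \<Sigma>" and Q: "finite Q" and \<delta>: "\<And>q c. q \<in> Q \<Longrightarrow> c \<in> \<Sigma> \<Longrightarrow> \<delta> q c \<in> Q"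
    and comm: "\<And>q u v w. q \<in> Q \<Longrightarrow> u \<in> lists \<Sigma> \<Longrightarrow> v \<in> lists \<Sigma> \<Longrightarrow> foldl \<delta> q u = q \<Longrightarrow>
      foldl \<delta> q v = q \<Longrightarrow> w \<in> lists \<Sigma> \<Longrightarrow> foldl \<delta> q w \<in> F \<Longrightarrow> u @ v = v @ u"
    and q: "q \<in> Q"
  shows "\<exists>R. simply_starred \<Sigma> R \<and>
    {w \<in> lists \<Sigma>. foldl \<delta> q w \<in> F \<and> (\<forall>x y. w = x @ y \<longrightarrow> foldl \<delta> q x \<notin> B)} \<subseteq> R \<and>
    R \<subseteq> {w \<in> lists \<Sigma>. foldl \<delta> q w \<in> F}"
  using q
\<comment> \<open>\<open>B\<close> collects the states that the run has left for good; every
  recursive call adds the current state \<open>q\<close> to it.\<close>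
proof (induction "card (Q - B)" arbitrary: q B rule: less_induct)
  case less
  let ?L = "\<lambda>q. {w \<in> lists \<Sigma>. foldl \<delta> q w \<in> F}"
  let ?M = "\<lambda>q B. {w \<in> lists \<Sigma>. foldl \<delta> q w \<in> F \<and> (\<forall>x y. w = x @ y \<longrightarrow> foldl \<delta> q x \<notin> B)}"
  show ?case
  proof (cases "q \<in> B \<or> ?L q = {}")
    case True
    \<comment> \<open>If \<open>q\<close> is in \<open>B\<close>, the empty prefix already violates
      the avoidance condition.\<close>
    then have "?M q B = {}" by fastforce
    then show ?thesis using simply_starred_empty by blast
  next
    case False
    \<comment> \<open>The word \<open>w0\<close> witnesses that \<open>q\<close> can still reach
      acceptance, which \<open>comm\<close> demands.\<close>
    then obtain w0 where w0: "w0 \<in> lists \<Sigma>" "foldl \<delta> q w0 \<in> F" by auto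
    obtain u where u: "u \<in> lists \<Sigma>" "foldl \<delta> q u = q"
      and pow: "\<And>v. v \<in> lists \<Sigma> \<Longrightarrow> foldl \<delta> q v = q \<Longrightarrow> \<exists>k. v = concat (replicate k u)"
      using commuting_loops_are_powers[of \<Sigma> \<delta> q] comm[OF less.prems _ _ _ _ w0] by blast
    have "Q - insert q B \<subset> Q - B" using False less.prems by auto
    then have "card (Q - insert q B) < card (Q - B)" using Q by (intro psubset_card_mono) auto
    then have "\<exists>R. simply_starred \<Sigma> R \<and> ?M (\<delta> q c) (insert q B) \<subseteq> R \<and> R \<subseteq> ?L (\<delta> q c)"
      if "c \<in> \<Sigma>" for c
      using less.hyps \<delta>[OF less.prems that] by blast
    then have "\<forall>c\<in>\<Sigma>. \<exists>R. simply_starred \<Sigma> R \<and> ?M (\<delta> q c) (insert q B) \<subseteq> R \<and> R \<subseteq> ?L (\<delta> q c)"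
      by (rule ballI)
    from bchoice[OF this] obtain R where R: "\<And>c. c \<in> \<Sigma> \<Longrightarrow> simply_starred \<Sigma> (R c)"
      and lower: "\<And>c. c \<in> \<Sigma> \<Longrightarrow> ?M (\<delta> q c) (insert q B) \<subseteq> R c"
      and upper: "\<And>c. c \<in> \<Sigma> \<Longrightarrow> R c \<subseteq> ?L (\<delta> q c)"
      by blast
    \<comment> \<open>\<open>T\<close> describes what follows the last visit to \<open>q\<close>:
      nothing (\<open>E\<close>), or a letter \<open>c\<close> and then a run that never returns to
      \<open>q\<close>.\<close>
    define E where "E = (if q \<in> F then {[]} else {} :: 'c list set)"
    define T where "T = E \<union> (\<Union>c\<in>\<Sigma>. (@) [c] ` R c)"
    let ?R = "{concat (replicate k u) @ w | k w. w \<in> T}"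
    have "simply_starred \<Sigma> T"
      unfolding T_def E_def
      by (intro simply_starred_Un simply_starred_UN \<Sigma> simply_starred_append_left)
        (auto simp: R simply_starred_empty simply_starred_Nil)
    then have "simply_starred \<Sigma> ?R" by (rule simply_starred_star_left[OF u(1)])
    moreover have "?R \<subseteq> ?L q"
    proof -
      have "foldl \<delta> q (concat (replicate k u)) = q" for k
        using u(2) by (induction k) auto
      moreover have pu: "concat (replicate k u) \<in> lists \<Sigma>" for k
        using u(1) by (induction k) auto
      moreover have "w \<in> lists \<Sigma> \<and> foldl \<delta> (\<delta> q c) w \<in> F" if "c \<in> \<Sigma>" "w \<in> R c" for c w
        using upper that by blast
      then have "T \<subseteq> ?L q" unfolding T_def E_def by (fastforce split: if_splits)
      then have "w \<in> lists \<Sigma>" "foldl \<delta> q w \<in> F" if "w \<in> T" for w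
        using that by auto
      ultimately have "concat (replicate k u) @ w \<in> ?L q" if "w \<in> T" for k w
        using pu[of k] that by (simp del: in_lists_conv_set)
      then show ?thesis by blast
    qed
    moreover have "?M q B \<subseteq> ?R"
    proof
      fix w assume w: "w \<in> ?M q B"
      then have avoid: "foldl \<delta> q x \<notin> B" if "w = x @ y" for x y using that by blast
      \<comment> \<open>The largest such \<open>n\<close> marks the last visit to \<open>q\<close>;
        the prefix before it is a loop, hence a power of \<open>u\<close>.\<close>
      let ?P = "\<lambda>n. n \<le> length w \<and> foldl \<delta> q (take n w) = q"
      have "?P 0" by simp
      then obtain n where n: "?P n" and max: "\<And>m. ?P m \<Longrightarrow> m \<le> n"
        using GreatestI_nat[of ?P 0 "length w"] Greatest_le_nat[of ?P _ "length w"] by blast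
      define y where "y = drop n w"
      have wy: "w = take n w @ y" by (simp add: y_def)
      have ty: "take n w \<in> lists \<Sigma>" "y \<in> lists \<Sigma>"
        using w by (auto simp: y_def dest: in_set_takeD in_set_dropD)
      obtain k where k: "take n w = concat (replicate k u)" using pow ty n by blast
      have fy: "foldl \<delta> q y \<in> F"
      proof -
        have "foldl \<delta> q w = foldl \<delta> (foldl \<delta> q (take n w)) y" by (subst wy) (rule foldl_append)
        then show ?thesis using w n by simp
      qed
      have "y \<in> T"
      proof (cases y)
        case Nil
        then show ?thesis using fy by (simp add: T_def E_def)
      next
        case (Cons c y')
        then have c: "c \<in> \<Sigma>" "y' \<in> lists \<Sigma>" using ty by auto
        have "foldl \<delta> (\<delta> q c) a \<notin> insert q B" if "y' = a @ b" for a b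
        proof -
          have w2: "w = (take n w @ c # a) @ b" using wy Cons that by simp
          have f: "foldl \<delta> q (take n w @ c # a) = foldl \<delta> (\<delta> q c) a" using n by simp
          \<comment> \<open>A later return would occur at position \<open>n + 1 + length a\<close>,
            the \<open>1\<close> counting the letter \<open>c\<close>, against the maximality of
            \<open>n\<close>.\<close>
          have "foldl \<delta> (\<delta> q c) a \<notin> B" using avoid[OF w2] f by simp
          moreover have "foldl \<delta> (\<delta> q c) a \<noteq> q"
          proof
            assume "foldl \<delta> (\<delta> q c) a = q"
            moreover have len: "length (take n w @ c # a) = n + 1 + length a" using n by simp
            moreover have "take (n + 1 + length a) w = take n w @ c # a"
              by (metis append_eq_conv_conj len w2)
            moreover have "n + 1 + length a \<le> length w" using arg_cong[OF w2, of length] len by simp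
            ultimately have "n + 1 + length a \<le> n" using max[of "n + 1 + length a"] f by simp
            then show False by simp
          qed
          ultimately show ?thesis by simp
        qed
        then have "y' \<in> ?M (\<delta> q c) (insert q B)" using c fy Cons by auto
        then have "y' \<in> R c" using lower[OF c(1)] by blast
        then show ?thesis using c Cons by (auto simp: T_def)
      qed
      then show "w \<in> ?R" using k wy by auto
    qed
    ultimately show ?thesis by blast
  qed
qed

lemma regular_polynomial_growth_simply_starred:
  assumes reg: "regular_lang \<Sigma> L"
    and growth: "polynomially_bounded (\<lambda>n. card {w \<in> L. length w \<le> n})"
  shows "simply_starred \<Sigma> L"
proof -
  obtain Q :: "nat set" and q0 \<delta> F where \<Sigma>: "finite \<Sigma>" and Q: "finite Q" "q0 \<in> Q"
    and \<delta>: "\<forall>q\<in>Q. \<forall>c\<in>\<Sigma>. \<delta> q c \<in> Q" and L: "L = {w \<in> lists \<Sigma>. foldl \<delta> q0 w \<in> F}"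
    using reg unfolding regular_lang_def by blast
  have fin: "finite {w \<in> L. length w \<le> n}" for n
    by (rule finite_subset[OF _ finite_lists_length_le[OF \<Sigma>, of n]]) (auto simp: L)
  \<comment> \<open>Only reachable states are kept: a word \<open>x\<close> leading to
    \<open>q\<close> and a word \<open>w\<close> from \<open>q\<close> to acceptance turn products
    of loops at \<open>q\<close> into words of \<open>L\<close>.\<close>
  define Q' where "Q' = foldl \<delta> q0 ` lists \<Sigma>"
  have run: "foldl \<delta> q x \<in> Q" if "x \<in> lists \<Sigma>" "q \<in> Q" for x q
    using that \<delta> by (induction x arbitrary: q) auto
  then have "Q' \<subseteq> Q" using Q unfolding Q'_def by auto
  then have Q': "finite Q'" using Q finite_subset by blast
  have \<delta>': "\<delta> q c \<in> Q'" if "q \<in> Q'" "c \<in> \<Sigma>" for q c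
  proof -
    from that obtain x where "x \<in> lists \<Sigma>" "q = foldl \<delta> q0 x" unfolding Q'_def by auto
    then show ?thesis unfolding Q'_def using that by (intro image_eqI[of _ _ "x @ [c]"]) auto
  qed
  have comm: "u @ v = v @ u" if q: "q \<in> Q'" and u: "u \<in> lists \<Sigma>" "foldl \<delta> q u = q"
    and v: "v \<in> lists \<Sigma>" "foldl \<delta> q v = q" and w: "w \<in> lists \<Sigma>" "foldl \<delta> q w \<in> F" for q u v w
  proof -
    from q obtain x where x: "x \<in> lists \<Sigma>" "q = foldl \<delta> q0 x" unfolding Q'_def by auto
    show ?thesis
    proof (rule loops_commute[OF fin growth])
      fix bs assume "set bs \<subseteq> {u @ v, v @ u}"
      then have "concat bs \<in> lists \<Sigma> \<and> foldl \<delta> q (concat bs) = q"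
        using u v by (induction bs) auto
      then show "x @ concat bs @ w \<in> L" using x w by (simp add: L)
    qed
  qed
  have "q0 \<in> Q'" unfolding Q'_def by (rule image_eqI[of _ _ "[]"]) auto
  then have "\<exists>R. simply_starred \<Sigma> R \<and>
      {w \<in> lists \<Sigma>. foldl \<delta> q0 w \<in> F \<and> (\<forall>x y. w = x @ y \<longrightarrow> foldl \<delta> q0 x \<notin> {})} \<subseteq> R \<and>
      R \<subseteq> {w \<in> lists \<Sigma>. foldl \<delta> q0 w \<in> F}"
    by (intro accepted_sandwich[OF \<Sigma> Q' \<delta>'] comm)
  \<comment> \<open>With \<open>B\<close> empty the avoidance condition is void, so both sides of
    the sandwich equal \<open>L\<close>.\<close>
  then obtain R where "simply_starred \<Sigma> R" "L \<subseteq> R" "R \<subseteq> L" by (auto simp: L)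
  then show ?thesis by (metis subset_antisym)
qed

section \<open>From the hypothesis on \<open>h\<close> to the growth of \<open>L\<close>\<close>

text \<open>Horner's scheme: each coefficient is replaced by an integer above its absolute value,
  and each factor \<open>x\<close> is bounded by \<open>x + 1\<close>.\<close>

lemma poly_le_monomial:
  fixes p :: "real poly"
  shows "\<exists>C d. \<forall>x\<ge>0. poly p x \<le> real C * (x + 1) ^ d"
proof (induction p)
  case 0
  show ?case by (intro exI[of _ 0]) simp
next
  case (pCons a p)
  then obtain C d where Cd: "\<And>x. x \<ge> 0 \<Longrightarrow> poly p x \<le> real C * (x + 1) ^ d" by blast
  define K where "K = nat \<lceil>\<bar>a\<bar>\<rceil>"
  have aK: "a \<le> real K" unfolding K_def by linarith
  have "poly (pCons a p) x \<le> real (K + C) * (x + 1) ^ Suc d" if x: "x \<ge> 0" for x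
  proof -
    have "x * poly p x \<le> x * (real C * (x + 1) ^ d)"
      using Cd[OF x] x by (rule mult_left_mono)
    also have "\<dots> \<le> (x + 1) * (real C * (x + 1) ^ d)"
      using x by (intro mult_right_mono) auto
    finally have "x * poly p x \<le> real C * (x + 1) ^ Suc d" by (simp add: mult_ac)
    moreover have "real K * 1 \<le> real K * (x + 1) ^ Suc d"
      using x by (intro mult_left_mono one_le_power) auto
    ultimately show ?thesis using aK by (simp only: poly_pCons of_nat_add distrib_right mult_1_right)
  qed
  then show ?case by blast
qed

lemma polynomially_bounded_if_preceq_poly:
  assumes "preceq (\<lambda>n. real (f n)) (\<lambda>n. poly p (real n))"
  shows "polynomially_bounded f"
proof -
  obtain N K M where M: "M > 0" and le: "\<And>n. n \<ge> N \<Longrightarrow> real (f n) \<le> real K * poly p (real (M * n))"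
    using assms unfolding preceq_def by blast
  obtain C d where Cd: "\<And>x. x \<ge> 0 \<Longrightarrow> poly p x \<le> real C * (x + 1) ^ d"
    using poly_le_monomial by blast
  \<comment> \<open>The sum covers the finitely many values below the threshold \<open>N\<close>;
    the factor \<open>M ^ d\<close> comes from \<open>M * n + 1 \<le> M * (n + 1)\<close>.\<close>
  have "f n \<le> (K * C * M ^ d + (\<Sum>i<N. f i)) * (n + 1) ^ d" for n
  proof (cases "n < N")
    case True
    then have "f n \<le> (\<Sum>i<N. f i)" by (intro member_le_sum) auto
    also have "\<dots> \<le> (K * C * M ^ d + (\<Sum>i<N. f i)) * 1" by simp
    also have "\<dots> \<le> (K * C * M ^ d + (\<Sum>i<N. f i)) * (n + 1) ^ d"
      by (intro mult_left_mono one_le_power) auto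
    finally show ?thesis .
  next
    case False
    then have "real (f n) \<le> real K * poly p (real (M * n))" using le by simp
    also have "\<dots> \<le> real K * (real C * (real (M * n) + 1) ^ d)"
      by (intro mult_left_mono Cd) auto
    also have "\<dots> = real (K * (C * (M * n + 1) ^ d))"
      by (simp add: add.commute)
    finally have "f n \<le> K * (C * (M * n + 1) ^ d)" by (simp only: of_nat_le_iff)
    also have "\<dots> \<le> K * (C * (M * (n + 1)) ^ d)"
      using M by (intro mult_left_mono power_mono) auto
    also have "\<dots> = K * C * M ^ d * (n + 1) ^ d" by (simp only: power_mult_distrib mult.assoc)
    also have "\<dots> \<le> (K * C * M ^ d + (\<Sum>i<N. f i)) * (n + 1) ^ d" by (intro mult_right_mono) auto
    finally show ?thesis .
  qed
  then show ?thesis unfolding polynomially_bounded_def by blast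
qed

lemma (in group) symm_gens_closed: "A \<subseteq> carrier G \<Longrightarrow> symm_gens G A \<subseteq> carrier G"
  unfolding symm_gens_def by auto

lemma (in group) generate_imp_eval_word:
  assumes A: "A \<subseteq> carrier G" and g: "g \<in> generate G A"
  shows "\<exists>w \<in> lists (symm_gens G A). eval_word G w = g"
  using g
proof induction
  case one
  show ?case by (intro bexI[of _ "[]"]) (auto simp: eval_word_def)
next
  case (incl h)
  then show ?case
    using A by (intro bexI[of _ "[h]"]) (auto simp: eval_word_def symm_gens_def)
next
  case (inv h)
  then show ?case
    using A by (intro bexI[of _ "[inv h]"]) (auto simp: eval_word_def symm_gens_def)
next
  case (eng h1 h2)
  then obtain w1 w2 where "w1 \<in> lists (symm_gens G A)" "eval_word G w1 = h1"
    "w2 \<in> lists (symm_gens G A)" "eval_word G w2 = h2" by auto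
  then show ?case
    using eval_word_append[OF _ _ symm_gens_closed[OF A]] by (intro bexI[of _ "w1 @ w2"]) auto
qed

text \<open>The \<open>LEAST\<close> in \<open>word_length\<close> is attained because elements of
  the generated subgroup are values of words.\<close>

lemma (in group) mem_word_ball_word_length:
  assumes "A \<subseteq> carrier G" "g \<in> generate G A"
  shows "g \<in> word_ball G (symm_gens G A) (word_length G A g)"
proof -
  let ?P = "\<lambda>n. \<exists>w \<in> lists (symm_gens G A). length w = n \<and> eval_word G w = g"
  have "\<exists>n. ?P n" using generate_imp_eval_word[OF assms] by auto
  then have "?P (word_length G A g)" unfolding word_length_def by (rule LeastI_ex)
  then show ?thesis unfolding word_ball_def by auto
qed

theorem mainTheorem11:
  fixes G :: "('a, 'b) monoid_scheme" and A :: "'a set"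
    and L :: "'a list set" and \<psi> :: "'a list \<Rightarrow> 'a"
  assumes "group G"
    and "finite A" and "A \<subseteq> carrier G" and "generate G A = carrier G"
    and "virtually_nilpotent G"
    and "cayley_automatic_rep G A L \<psi>"
    and "\<exists>p :: real poly. preceq (\<lambda>n. real (fellow_dist G A L \<psi> n)) (\<lambda>n. poly p (real n))"
  shows "simply_starred (symm_gens G A) L"
proof -
  interpret group G by (rule assms(1))
  let ?S = "symm_gens G A"
  let ?h = "fellow_dist G A L \<psi>"
  note A = \<open>A \<subseteq> carrier G\<close>
  have S: "finite ?S" "?S \<subseteq> carrier G"
    using \<open>finite A\<close> symm_gens_closed[OF A] by (auto simp: symm_gens_def)
  have LS: "L \<subseteq> lists ?S" and reg: "regular_lang ?S L" and bij: "bij_betw \<psi> L (carrier G)"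
    using \<open>cayley_automatic_rep G A L \<psi>\<close> unfolding cayley_automatic_rep_def by blast+
  have fin: "finite {w \<in> L. length w \<le> n}" for n
    by (rule finite_subset[OF _ finite_lists_length_le[OF S(1), of n]]) (use LS in auto)
  obtain C d where Cd: "\<And>n. ?h n \<le> C * (n + 1) ^ d"
    using assms(7) polynomially_bounded_if_preceq_poly unfolding polynomially_bounded_def by blast
  obtain C' d' where Cd': "\<And>n. card (word_ball G ?S n) \<le> C' * (n + 1) ^ d'"
    using virtually_nilpotent_growth[OF \<open>virtually_nilpotent G\<close> S]
    unfolding polynomially_bounded_def by blast
  \<comment> \<open>Here \<open>\<psi> w\<close> is \<open>eval_word G w\<close> times
    \<open>?g\<close>; the first factor has length at most \<open>n\<close>, the second at most
    \<open>?h n\<close>.\<close>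
  have image: "\<psi> ` {w \<in> L. length w \<le> n} \<subseteq> word_ball G ?S (n + ?h n)" for n
  proof clarify
    fix w assume w: "w \<in> L" "length w \<le> n"
    let ?g = "inv\<^bsub>G\<^esub> (eval_word G w) \<otimes>\<^bsub>G\<^esub> \<psi> w"
    have c: "eval_word G w \<in> carrier G" "\<psi> w \<in> carrier G"
      using eval_word_closed[OF _ S(2)] LS bij w by (auto dest: bij_betwE)
    have "word_length G A ?g \<le> ?h n"
      unfolding fellow_dist_def
    proof (rule Max_ge)
      have "{word_dist G A (eval_word G w) (\<psi> w) | w. w \<in> L \<and> length w \<le> n} =
          (\<lambda>w. word_dist G A (eval_word G w) (\<psi> w)) ` {w \<in> L. length w \<le> n}" by blast
      then show "finite (insert 0 {word_dist G A (eval_word G w) (\<psi> w) | w. w \<in> L \<and> length w \<le> n})"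
        using fin by simp
      have "word_length G A ?g = word_dist G A (eval_word G w) (\<psi> w)"
        by (simp add: word_dist_def)
      then show "word_length G A ?g \<in>
          insert 0 {word_dist G A (eval_word G w) (\<psi> w) | w. w \<in> L \<and> length w \<le> n}"
        using w by blast
    qed
    moreover have "?g \<in> word_ball G ?S (word_length G A ?g)"
      using mem_word_ball_word_length[OF A] c \<open>generate G A = carrier G\<close> by simp
    ultimately have g: "?g \<in> word_ball G ?S (?h n)" using word_ball_weaken by metis
    have "eval_word G w \<in> word_ball G ?S n"
      unfolding word_ball_def using w LS by auto
    from word_ball_mult[OF S(2) this g] show "\<psi> w \<in> word_ball G ?S (n + ?h n)"
      using c by (simp add: m_assoc[symmetric])
  qed
  \<comment> \<open>Since \<open>\<psi>\<close> is injective, the words are counted by a ball whose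
    radius is polynomial in \<open>n\<close>, and the two polynomial bounds compose.\<close>
  have "card {w \<in> L. length w \<le> n} \<le> (C' * (C + 1) ^ d') * (n + 1) ^ (Suc d * d')" for n
  proof -
    have "inj_on \<psi> {w \<in> L. length w \<le> n}"
      using bij_betw_imp_inj_on[OF bij] by (rule inj_on_subset) auto
    then have "card {w \<in> L. length w \<le> n} \<le> card (word_ball G ?S (n + ?h n))"
      using image finite_word_ball[OF S(1)] by (rule card_inj_on_le)
    also have "\<dots> \<le> C' * (n + ?h n + 1) ^ d'" by (rule Cd')
    also have "\<dots> \<le> C' * ((C + 1) * (n + 1) ^ Suc d) ^ d'"
    proof (intro mult_left_mono power_mono)
      define m where "m = (n + 1) ^ Suc d"
      have "(n + 1) * 1 \<le> (n + 1) * (n + 1) ^ d" by (intro mult_left_mono one_le_power) auto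
      then have "n + 1 \<le> m" by (simp add: m_def)
      moreover have "C * (n + 1) ^ d \<le> C * m"
        unfolding m_def by (intro mult_left_mono power_increasing) auto
      then have "?h n \<le> C * m" using Cd[of n] by (rule order_trans[rotated])
      ultimately show "n + ?h n + 1 \<le> (C + 1) * (n + 1) ^ Suc d"
        unfolding m_def[symmetric] distrib_right mult_1 by linarith
    qed auto
    also have "\<dots> = (C' * (C + 1) ^ d') * (n + 1) ^ (Suc d * d')"
      by (simp only: power_mult_distrib power_mult mult.assoc)
    finally show ?thesis .
  qed
  then have "polynomially_bounded (\<lambda>n. card {w \<in> L. length w \<le> n})"
    unfolding polynomially_bounded_def by blast
  with reg show ?thesis by (rule regular_polynomial_growth_simply_starred)
qed

end
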